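(* Every compact subset of $\mathbb{R}^2$ is a good set.
   Context: A figure is any subset of $\mathbb{R}^2$. An isometry (rigid motion) is a map $f:\mathbb{R}^2\to\mathbb{R}^2$ preserving the Euclidean distance. For figures $S_1,S_2$: $S_1\approx S_2$ (geometrically equal) means there is an isometry $f$ of $\mathbb{R}^2$ with $f(S_1)=S_2$; $S_1\le S_2$ means there is an isometry $f$ of $\mathbb{R}^2$ with $f(S_1)\subseteq S_2$. A figure $A\subseteq\mathbb{R}^2$ is good if for every figure $B\subseteq\mathbb{R}^2$, $A\le B$ and $B\le A$ together imply $A\approx B$. *)

theory Defs
  imports "HOL-Analysis.Analysis"
begin

type_synonym figure = "(real ^ 2) set"

definition plane_isometry :: "(real ^ 2 \<Rightarrow> real ^ 2) \<Rightarrow> bool" where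
  "plane_isometry f \<longleftrightarrow> (\<forall>x y. dist (f x) (f y) = dist x y)"

definition geom_equal :: "figure \<Rightarrow> figure \<Rightarrow> bool" where
  "geom_equal S T \<longleftrightarrow> (\<exists>f. plane_isometry f \<and> f ` S = T)"

definition geom_le :: "figure \<Rightarrow> figure \<Rightarrow> bool" where
  "geom_le S T \<longleftrightarrow> (\<exists>f. plane_isometry f \<and> f ` S \<subseteq> T)"

definition good :: "figure \<Rightarrow> bool" where
  "good A \<longleftrightarrow> (\<forall>B. geom_le A B \<longrightarrow> geom_le B A \<longrightarrow> geom_equal A B)"

end

theory Submission
  imports Defs
begin

text \<open>
  If \<open>f ` A \<subseteq> B\<close> and \<open>g ` B \<subseteq> A\<close>, then \<open>g \<circ> f\<close> is an isometric self-map of the compact set \<open>A\<close>,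
  hence surjective: the orbit of a point at distance \<open>e > 0\<close> from the image would be an
  \<open>e\<close>-separated sequence in \<open>A\<close>. Injectivity of \<open>g\<close> then gives \<open>f ` A = B\<close>.
\<close>

lemma compact_isometry_image_eq:
  fixes S :: "'a::metric_space set"
  assumes S: "compact S" and hS: "h ` S \<subseteq> S"
    and iso: "\<And>x y. x \<in> S \<Longrightarrow> y \<in> S \<Longrightarrow> dist (h x) (h y) = dist x y"
  shows "h ` S = S"
proof (rule ccontr)
  assume "h ` S \<noteq> S"
  then obtain x where x: "x \<in> S" "x \<notin> h ` S"
    using hS by blast
  have "continuous_on S h"
    unfolding continuous_on_iff by (auto simp: iso)
  then have "closed (h ` S)"
    using S compact_continuous_image compact_imp_closed by blast
  then have "\<exists>e>0. \<forall>y. dist y x < e \<longrightarrow> y \<in> - h ` S"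
    using x(2) by (simp add: closed_def open_dist)
  then obtain e where e: "e > 0" "\<And>y. y \<in> h ` S \<Longrightarrow> e \<le> dist y x"
    by (meson ComplD not_less)
  define u where "u n = (h ^^ n) x" for n
  have u: "u n \<in> S" for n
    using hS by (induction n) (auto simp: u_def x(1))
  have u_Suc: "u (Suc n) = h (u n)" for n
    by (simp add: u_def)
  \<comment> \<open>Each step of the orbit applies \<open>h\<close> to both points, and the orbit
    stays in \<open>S\<close>, where \<open>iso\<close> is available.\<close>
  have shift: "dist (u (n + k)) (u n) = dist (u k) (u 0)" for n k
    by (induction n) (simp_all add: u_Suc iso u)
  have separated: "e \<le> dist (u m) (u n)" if "n < m" for m n
  proof -
    \<comment> \<open>The gap is written as a successor so that \<open>u (Suc k) = h (u k)\<close>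
      lies in the image, at distance at least \<open>e\<close> from \<open>u 0 = x\<close>.\<close>
    from less_imp_Suc_add[OF that] obtain k where k: "m = n + Suc k"
      by auto
    have "e \<le> dist (u (Suc k)) (u 0)"
      using e(2)[of "u (Suc k)"] u[of k] by (simp add: u_Suc) (simp add: u_def)
    then show ?thesis
      unfolding k shift[of n "Suc k"] .
  qed
  \<comment> \<open>A convergent subsequence is Cauchy, so two of its terms come closer than
    \<open>e\<close>.\<close>
  obtain l r where "strict_mono r" and lim: "(u \<circ> r) \<longlonglongrightarrow> l"
    using S u seq_compactE compact_imp_seq_compact by metis
  obtain N where "\<And>m n. m \<ge> N \<Longrightarrow> n \<ge> N \<Longrightarrow> dist ((u \<circ> r) m) ((u \<circ> r) n) < e"
    using LIMSEQ_imp_Cauchy[OF lim] e(1) unfolding Cauchy_def by blast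
  then have "dist (u (r (Suc N))) (u (r N)) < e"
    by simp
  moreover have "r N < r (Suc N)"
    using \<open>strict_mono r\<close> by (simp add: strict_mono_Suc_iff)
  ultimately show False
    using separated by force
qed

theorem proposition1p5:
  fixes A :: figure
  assumes "compact A"
  shows "good A"
  unfolding good_def
proof (intro allI impI)
  fix B :: figure
  assume "geom_le A B" "geom_le B A"
  then obtain f g where f: "plane_isometry f" "f ` A \<subseteq> B" and g: "plane_isometry g" "g ` B \<subseteq> A"
    unfolding geom_le_def by blast
  have "(g \<circ> f) ` A \<subseteq> A"
    using f(2) g(2) by fastforce
  then have "(g \<circ> f) ` A = A"
    using f(1) g(1) by (intro compact_isometry_image_eq assms) (simp_all add: plane_isometry_def)
  \<comment> \<open>Replacing \<open>A\<close> by \<open>g\<close> f \<open>A\<close> puts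
    \<open>g\<close> on both sides, ready to be cancelled.\<close>
  then have "g ` B \<subseteq> g ` f ` A"
    using g(2) by (simp add: image_comp)
  moreover have "inj g"
    using g(1) unfolding plane_isometry_def by (metis injI dist_eq_0_iff)
  ultimately have "B \<subseteq> f ` A"
    by (simp add: inj_image_subset_iff)
  then show "geom_equal A B"
    unfolding geom_equal_def using f by blast
qed

end
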